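(* (a) For every $(\beta^1,\beta^2)\in\mathbb R^\tau\times\mathbb R^{\sigma-\tau}$, $$\mathcal E_{\beta^1,\beta^2}=\bigcup_{u^2\in\tilde H^2(\mathcal E_{\beta^1,\beta^2})}\mathcal E_{\beta^1}^{u^2}.$$ (b) Let $\beta^1\in\mathbb R^\tau$ and $u^2\in\operatorname{dom}s_{\beta^1}$. (Full equivalence) If $u^2\in C_{\beta^1}$ and $u^2\in T_{\beta^1}$, then there exists $\beta^2\in\partial s_{\beta^1}^{**}(u^2)$ such that $\mathcal E_{\beta^1}^{u^2}=\mathcal E_{\beta^1,\beta^2}$. (Partial equivalence) If $u^2\in C_{\beta^1}$ and $u^2\notin T_{\beta^1}$, then $\mathcal E_{\beta^1}^{u^2}\subsetneq\mathcal E_{\beta^1,\beta^2}$ for all $\beta^2\in\partial s_{\beta^1}^{**}(u^2)$. (Nonequivalence) If $u^2\notin C_{\beta^1}$, then $\mathcal E_{\beta^1}^{u^2}\cap\mathcal E_{\beta^1,\beta^2}=\emptyset$ for all $\beta^2\in\mathbb R^{\sigma-\tau}$.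
   Context: Setting. For each $n\in\mathbb N$, $(\Omega_n,\mathcal F_n,P_n)$ is a probability space; $\sigma\ge2$ is an integer; $H_{n,1},\dots,H_{n,\sigma}:\Omega_n\to\mathbb R$ are bounded measurable functions; $a_n>0$ with $a_n\to\infty$. $\mathcal X$ is a Polish space, $Y_n:\Omega_n\to\mathcal X$ are random variables, and $\tilde H_1,\dots,\tilde H_\sigma:\mathcal X\to\mathbb R$ are bounded continuous functions such that $\lim_{n\to\infty}\sup_{\omega\in\Omega_n}|H_{n,i}(\omega)-\tilde H_i(Y_n(\omega))|=0$ for each $i$. With respect to $P_n$, $Y_n$ satisfies the large deviation principle on $\mathcal X$ with scaling constants $a_n$ and rate function $I:\mathcal X\to[0,\infty]$, where rate functions have compact level sets $\{I\le M\}$, $0\le M<\infty$ (in particular $\inf_{\mathcal X}I=0$). $\langle\cdot,\cdot\rangle$ denotes Euclidean inner products. $\tau$ is an integer with $1\le\tau\le\sigma$ (with $\mathbb R^0$ a single point if $\tau=\sigma$); $\tilde H^1:=(\tilde H_1,\dots,\tilde H_\tau)$, $\tilde H^2:=(\tilde H_{\tau+1},\dots,\tilde H_\sigma)$. Definitions. Canonical equilibrium macrostates: $\mathcal E_{\beta^1,\beta^2}$ is the set of minimizers over $x\in\mathcal X$ of $I(x)+\langle\beta^1,\tilde H^1(x)\rangle+\langle\beta^2,\tilde H^2(x)\rangle$. $J^2(u^2):=\inf\{I(x):x\in\mathcal X,\tilde H^2(x)=u^2\}$ (with $\inf\emptyset=\infty$), $\operatorname{dom}J^2:=\{u^2:J^2(u^2)<\infty\}$.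 Mixed equilibrium macrostates, for $\beta^1\in\mathbb R^\tau$, $u^2\in\operatorname{dom}J^2$: $\mathcal E_{\beta^1}^{u^2}:=\{x\in\mathcal X:\tilde H^2(x)=u^2,\ I(x)+\langle\beta^1,\tilde H^1(x)\rangle=\inf\{I(y)+\langle\beta^1,\tilde H^1(y)\rangle:\tilde H^2(y)=u^2\}\}$. For $\beta^1\in\mathbb R^\tau$ and $u^2\in\mathbb R^{\sigma-\tau}$: $$s_{\beta^1}(u^2):=-\inf\{I(x)+\langle\beta^1,\tilde H^1(x)\rangle:\tilde H^2(x)=u^2\}+\inf_{y\in\mathcal X}\{I(y)+\langle\beta^1,\tilde H^1(y)\rangle\},$$ $\operatorname{dom}s_{\beta^1}:=\{u^2:s_{\beta^1}(u^2)>-\infty\}=\operatorname{dom}J^2$. Its Legendre–Fenchel transform is $s_{\beta^1}^*(\beta^2):=\inf_{w\in\mathbb R^{\sigma-\tau}}\{\langle\beta^2,w\rangle-s_{\beta^1}(w)\}$, and $s_{\beta^1}^{**}:=(s_{\beta^1}^* )^*$, i.e. $s_{\beta^1}^{**}(u^2)=\inf_{\beta^2}\{\langle\beta^2,u^2\rangle-s_{\beta^1}^*(\beta^2)\}$. $\partial s_{\beta^1}^{**}(u^2)$ is the set of $\beta^2\in\mathbb R^{\sigma-\tau}$ with $s_{\beta^1}^{**}(w)\le s_{\beta^1}^{**}(u^2)+\langle\beta^2,w-u^2\rangle$ for all $w\in\mathbb R^{\sigma-\tau}$. $C_{\beta^1}$ is the set of $u^2\in\mathbb R^{\sigma-\tau}$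 for which there exists $\beta^2\in\mathbb R^{\sigma-\tau}$ such that $s_{\beta^1}(w)\le s_{\beta^1}(u^2)+\langle\beta^2,w-u^2\rangle$ for all $w\in\mathbb R^{\sigma-\tau}$; $T_{\beta^1}$ is the set of $u^2\in\mathbb R^{\sigma-\tau}$ for which there exists $\beta^2\in\mathbb R^{\sigma-\tau}$ such that $s_{\beta^1}(w)<s_{\beta^1}(u^2)+\langle\beta^2,w-u^2\rangle$ for all $w\ne u^2$. *)

theory Defs
  imports "HOL-Probability.Probability" "Jordan_Normal_Form.Matrix"
begin

(* Vectors are elements of carrier_vec d with d a natural number, so that the dimension 0
   (a single point) is included. Their components are indexed from 0. *)

subsection \<open>Large deviation principle\<close>

text \<open>Here \<open>log 0 = -\<infinity>\<close>, whereas the library's \<open>ln 0\<close> on the reals is \<open>0\<close>.\<close>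

definition ereal_ln :: "real \<Rightarrow> ereal" where
  "ereal_ln p = (if p = 0 then -\<infinity> else ereal (ln p))"

definition rate_function :: "('x::topological_space \<Rightarrow> ereal) \<Rightarrow> bool" where
  "rate_function I \<longleftrightarrow> (\<forall>x. 0 \<le> I x) \<and> (\<forall>L::real. 0 \<le> L \<longrightarrow> compact {x. I x \<le> ereal L})"

definition large_deviation_principle ::
  "(nat \<Rightarrow> 'w measure) \<Rightarrow> (nat \<Rightarrow> 'w \<Rightarrow> 'x::topological_space) \<Rightarrow> (nat \<Rightarrow> real) \<Rightarrow>
    ('x \<Rightarrow> ereal) \<Rightarrow> bool" where
  "large_deviation_principle M Y a I \<longleftrightarrow>
     (\<forall>F. closed F \<longrightarrow>
        limsup (\<lambda>n. ereal (1 / a n) * ereal_ln (measure (M n) (Y n -` F \<inter> space (M n))))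
          \<le> - (INF x\<in>F. I x)) \<and>
     (\<forall>G. open G \<longrightarrow>
        - (INF x\<in>G. I x)
          \<le> liminf (\<lambda>n. ereal (1 / a n) * ereal_ln (measure (M n) (Y n -` G \<inter> space (M n)))))"

subsection \<open>Equilibrium macrostates\<close>

definition canonical_macrostates ::
  "('x \<Rightarrow> ereal) \<Rightarrow> ('x \<Rightarrow> real vec) \<Rightarrow> ('x \<Rightarrow> real vec) \<Rightarrow> real vec \<Rightarrow> real vec \<Rightarrow> 'x set" where
  "canonical_macrostates I H1 H2 \<beta>1 \<beta>2 =
     {x. \<forall>y. I x + ereal (\<beta>1 \<bullet> H1 x) + ereal (\<beta>2 \<bullet> H2 x)
             \<le> I y + ereal (\<beta>1 \<bullet> H1 y) + ereal (\<beta>2 \<bullet> H2 y)}"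

definition mixed_macrostates ::
  "('x \<Rightarrow> ereal) \<Rightarrow> ('x \<Rightarrow> real vec) \<Rightarrow> ('x \<Rightarrow> real vec) \<Rightarrow> real vec \<Rightarrow> real vec \<Rightarrow> 'x set" where
  "mixed_macrostates I H1 H2 \<beta>1 u2 =
     {x. H2 x = u2 \<and>
         I x + ereal (\<beta>1 \<bullet> H1 x) = (INF y\<in>{y. H2 y = u2}. I y + ereal (\<beta>1 \<bullet> H1 y))}"

definition mixed_entropy ::
  "('x \<Rightarrow> ereal) \<Rightarrow> ('x \<Rightarrow> real vec) \<Rightarrow> ('x \<Rightarrow> real vec) \<Rightarrow> real vec \<Rightarrow> real vec \<Rightarrow> ereal" where
  "mixed_entropy I H1 H2 \<beta>1 u2 =
     - (INF x\<in>{x. H2 x = u2}. I x + ereal (\<beta>1 \<bullet> H1 x)) + (INF y. I y + ereal (\<beta>1 \<bullet> H1 y))"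

subsection \<open>Concave duality on the space of d-dimensional vectors\<close>

definition concave_dom :: "nat \<Rightarrow> (real vec \<Rightarrow> ereal) \<Rightarrow> real vec set" where
  "concave_dom d s = {u \<in> carrier_vec d. s u > -\<infinity>}"

definition legendre_fenchel :: "nat \<Rightarrow> (real vec \<Rightarrow> ereal) \<Rightarrow> real vec \<Rightarrow> ereal" where
  "legendre_fenchel d s \<beta> = (INF w\<in>carrier_vec d. ereal (\<beta> \<bullet> w) - s w)"

definition superdifferential :: "nat \<Rightarrow> (real vec \<Rightarrow> ereal) \<Rightarrow> real vec \<Rightarrow> real vec set" where
  "superdifferential d s u =
     {\<beta> \<in> carrier_vec d. \<forall>w\<in>carrier_vec d. s w \<le> s u + ereal (\<beta> \<bullet> (w - u))}"

text \<open>Points admitting a supporting hyperplane (the set \<open>C\<close>), and a strictly supporting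
  one (the set \<open>T\<close>).\<close>

definition support_points :: "nat \<Rightarrow> (real vec \<Rightarrow> ereal) \<Rightarrow> real vec set" where
  "support_points d s =
     {u \<in> carrier_vec d. \<exists>\<beta>\<in>carrier_vec d. \<forall>w\<in>carrier_vec d.
        s w \<le> s u + ereal (\<beta> \<bullet> (w - u))}"

definition strict_support_points :: "nat \<Rightarrow> (real vec \<Rightarrow> ereal) \<Rightarrow> real vec set" where
  "strict_support_points d s =
     {u \<in> carrier_vec d. \<exists>\<beta>\<in>carrier_vec d. \<forall>w\<in>carrier_vec d.
        w \<noteq> u \<longrightarrow> s w < s u + ereal (\<beta> \<bullet> (w - u))}"

end

theory Submission
  imports Defs
begin

text \<open>
  Write \<open>f = I + \<langle>\<beta>\<^sup>1, H\<^sup>1\<rangle>\<close> and \<open>g(u) = inf {f(x) | H\<^sup>2(x) = u}\<close>, so that \<open>s = const - g\<close>.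
  Minimizing \<open>f + \<langle>\<beta>\<^sup>2, H\<^sup>2\<rangle>\<close> over the whole space amounts to minimizing \<open>f\<close> on each fibre of
  \<open>H\<^sup>2\<close> and then minimizing \<open>g(u) + \<langle>\<beta>\<^sup>2, u\<rangle>\<close> over \<open>u\<close>. Since \<open>u\<close> minimizes the latter exactly
  when \<open>\<beta>\<^sup>2 \<in> \<partial>s(u)\<close>, this gives the criterion behind all assertions
  (\<open>canonical_iff_mixed_and_superdifferential\<close>): \<open>x\<close> is a canonical macrostate for \<open>\<beta>\<^sup>2\<close> if and
  only if it is a mixed macrostate for \<open>u = H\<^sup>2(x)\<close> and \<open>\<beta>\<^sup>2 \<in> \<partial>s(u)\<close>.

  Part (a) is immediate, because the second condition depends on \<open>x\<close> only through \<open>H\<^sup>2(x)\<close>.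
  Nonequivalence holds because \<open>\<partial>s(u)\<close> is empty. When \<open>\<partial>s(u)\<close> is nonempty, \<open>s\<close> and its bidual
  have the same superdifferential at \<open>u\<close> (\<open>superdifferential_bidual\<close>), so every fibre
  minimizer over \<open>u\<close> is canonical for each \<open>\<beta>\<^sup>2\<close> in it. A canonical macrostate over a different
  \<open>w\<close> would mean \<open>\<beta>\<^sup>2 \<in> \<partial>s(w)\<close>, that is, the supporting hyperplane at \<open>u\<close> touches \<open>s\<close> also at
  \<open>w\<close>. Strictness excludes this. If instead the hyperplane does touch at some \<open>w \<noteq> u\<close>, a canonical
  macrostate outside the mixed set exists as soon as the minimum over the fibre of \<open>w\<close> is attained,
  and attainment is the compactness of the level sets of \<open>I\<close>
  (\<open>rate_function_perturbed_attains_INF\<close>).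
\<close>

section \<open>Superdifferentials\<close>

lemma scalar_prod_diff_right:
  fixes \<beta> u w :: "real vec"
  assumes "\<beta> \<in> carrier_vec d" "u \<in> carrier_vec d" "w \<in> carrier_vec d"
  shows "\<beta> \<bullet> (w - u) = \<beta> \<bullet> w - \<beta> \<bullet> u"
  using assms by (simp add: scalar_prod_minus_distrib)

lemma bidual_upper:
  assumes u: "u \<in> carrier_vec d"
  shows "s u \<le> legendre_fenchel d (legendre_fenchel d s) u"
  unfolding legendre_fenchel_def[of d "legendre_fenchel d s"]
proof (rule INF_greatest)
  fix \<beta> :: "real vec" assume \<beta>: "\<beta> \<in> carrier_vec d"
  have "legendre_fenchel d s \<beta> \<le> ereal (\<beta> \<bullet> u) - s u"
    unfolding legendre_fenchel_def using u by (rule INF_lower)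
  then have "s u \<le> ereal (\<beta> \<bullet> u) - legendre_fenchel d s \<beta>"
    by (cases "s u"; cases "legendre_fenchel d s \<beta>") auto
  then show "s u \<le> ereal (u \<bullet> \<beta>) - legendre_fenchel d s \<beta>"
    using comm_scalar_prod[OF u \<beta>] by simp
qed

text \<open>A supporting hyperplane of \<open>s\<close> at \<open>u\<close> is an affine majorant of \<open>s\<close>, hence also of the
  bidual, which is therefore squeezed to the value \<open>s u\<close> at \<open>u\<close>.\<close>

lemma bidual_le_support:
  fixes s :: "real vec \<Rightarrow> ereal" and \<beta> u w :: "real vec"
  assumes u: "u \<in> carrier_vec d" and fin: "\<bar>s u\<bar> \<noteq> \<infinity>"
    and \<beta>: "\<beta> \<in> superdifferential d s u" and w: "w \<in> carrier_vec d"
  shows "legendre_fenchel d (legendre_fenchel d s) w \<le> s u + ereal (\<beta> \<bullet> (w - u))"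
proof -
  have \<beta>c: "\<beta> \<in> carrier_vec d"
    and sup: "\<And>v. v \<in> carrier_vec d \<Longrightarrow> s v \<le> s u + ereal (\<beta> \<bullet> (v - u))"
    using \<beta> by (auto simp: superdifferential_def)
  obtain r where r: "s u = ereal r" using fin by auto
  have "ereal (\<beta> \<bullet> u - r) \<le> legendre_fenchel d s \<beta>"
    unfolding legendre_fenchel_def
  proof (rule INF_greatest)
    fix v :: "real vec" assume v: "v \<in> carrier_vec d"
    show "ereal (\<beta> \<bullet> u - r) \<le> ereal (\<beta> \<bullet> v) - s v"
      using sup[OF v] by (cases "s v") (auto simp: r scalar_prod_diff_right[OF \<beta>c u v])
  qed
  moreover have "legendre_fenchel d (legendre_fenchel d s) w
      \<le> ereal (w \<bullet> \<beta>) - legendre_fenchel d s \<beta>"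
    unfolding legendre_fenchel_def[of d "legendre_fenchel d s"] using \<beta>c by (rule INF_lower)
  moreover have "w \<bullet> \<beta> = \<beta> \<bullet> w" using comm_scalar_prod[OF w \<beta>c] .
  ultimately have "legendre_fenchel d (legendre_fenchel d s) w
      \<le> ereal (\<beta> \<bullet> w) - ereal (\<beta> \<bullet> u - r)"
    by (metis ereal_minus_mono order.refl order.trans)
  then show ?thesis by (simp add: r scalar_prod_diff_right[OF \<beta>c u w] algebra_simps)
qed

lemma superdifferential_bidual:
  assumes u: "u \<in> carrier_vec d" and fin: "\<bar>s u\<bar> \<noteq> \<infinity>"
    and ne: "superdifferential d s u \<noteq> {}"
  shows "superdifferential d (legendre_fenchel d (legendre_fenchel d s)) u
         = superdifferential d s u"
    (is "superdifferential d ?b u = _")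
proof -
  obtain \<beta>0 where \<beta>0: "\<beta>0 \<in> superdifferential d s u" using ne by auto
  then have "\<beta>0 \<bullet> (u - u) = 0"
    using scalar_prod_diff_right[OF _ u u] by (auto simp: superdifferential_def)
  then have "?b u \<le> s u" using bidual_le_support[where s = s, OF u fin \<beta>0 u] by (simp add: zero_ereal_def)
  then have eq: "?b u = s u" using bidual_upper[OF u, of s] by simp
  show ?thesis
  proof (intro equalityI subsetI)
    fix \<beta> assume "\<beta> \<in> superdifferential d ?b u"
    then show "\<beta> \<in> superdifferential d s u"
      unfolding superdifferential_def eq using bidual_upper[of _ d s] by (auto intro: order.trans)
  next
    fix \<beta> assume \<beta>: "\<beta> \<in> superdifferential d s u"
    then show "\<beta> \<in> superdifferential d ?b u"
      using bidual_le_support[where s = s, OF u fin \<beta>] by (auto simp: superdifferential_def eq)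
  qed
qed

text \<open>A slope and a contact point determine an affine function, so the majorant of \<open>s\<close> with
  slope \<open>\<beta>\<close> through its contact at \<open>u\<close> is the same as the one through its contact at \<open>w\<close>.\<close>

lemma superdifferential_touching:
  fixes s :: "real vec \<Rightarrow> ereal" and \<beta> u w :: "real vec"
  assumes u: "u \<in> carrier_vec d" and w: "w \<in> carrier_vec d"
    and fin: "\<bar>s u\<bar> \<noteq> \<infinity>"
    and \<beta>: "\<beta> \<in> superdifferential d s u"
    and touch: "s u + ereal (\<beta> \<bullet> (w - u)) \<le> s w"
  shows "\<beta> \<in> superdifferential d s w"
proof -
  have \<beta>c: "\<beta> \<in> carrier_vec d"
    and sup: "\<And>v. v \<in> carrier_vec d \<Longrightarrow> s v \<le> s u + ereal (\<beta> \<bullet> (v - u))"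
    using \<beta> by (auto simp: superdifferential_def)
  obtain r where r: "s u = ereal r" using fin by auto
  have "s v \<le> s w + ereal (\<beta> \<bullet> (v - w))" if v: "v \<in> carrier_vec d" for v
    using sup[OF v] touch
    by (cases "s v"; cases "s w")
      (auto simp: r scalar_prod_diff_right[OF \<beta>c u v] scalar_prod_diff_right[OF \<beta>c u w]
        scalar_prod_diff_right[OF \<beta>c w v])
  then show ?thesis using \<beta>c by (simp add: superdifferential_def)
qed

lemma strict_support_excludes_other_support:
  fixes s :: "real vec \<Rightarrow> ereal" and \<beta> u v :: "real vec"
  assumes u: "u \<in> carrier_vec d" and v: "v \<in> carrier_vec d"
    and strict: "s v < s u + ereal (\<beta> \<bullet> (v - u))"
  shows "\<beta> \<notin> superdifferential d s v"
proof
  assume "\<beta> \<in> superdifferential d s v"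
  then have \<beta>c: "\<beta> \<in> carrier_vec d" and "s u \<le> s v + ereal (\<beta> \<bullet> (u - v))"
    using u by (auto simp: superdifferential_def)
  with strict show False
    by (cases "s u"; cases "s v")
      (auto simp: scalar_prod_diff_right[OF \<beta>c u v] scalar_prod_diff_right[OF \<beta>c v u])
qed

section \<open>Canonical and mixed macrostates\<close>

lemma le_INF_add_real_iff:
  fixes f :: "'x \<Rightarrow> ereal"
  shows "a \<le> (INF y\<in>S. f y) + ereal r \<longleftrightarrow> (\<forall>y\<in>S. a \<le> f y + ereal r)"
proof -
  have shift: "a \<le> b + ereal r \<longleftrightarrow> a - ereal r \<le> b" for b
    by (cases a; cases b) auto
  show ?thesis unfolding shift le_INF_iff ..
qed

lemma mixed_entropy_support_iff:
  fixes I :: "'x \<Rightarrow> ereal" and H1 H2 :: "'x \<Rightarrow> real vec" and \<beta>1 \<beta> u w :: "real vec"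
  assumes \<phi>: "(INF y. I y + ereal (\<beta>1 \<bullet> H1 y)) = ereal \<phi>"
    and \<beta>: "\<beta> \<in> carrier_vec d" and u: "u \<in> carrier_vec d" and w: "w \<in> carrier_vec d"
    and g: "\<And>v. g v = (INF x\<in>{x. H2 x = v}. I x + ereal (\<beta>1 \<bullet> H1 x))"
  shows "mixed_entropy I H1 H2 \<beta>1 w \<le> mixed_entropy I H1 H2 \<beta>1 u + ereal (\<beta> \<bullet> (w - u))
    \<longleftrightarrow> g u + ereal (\<beta> \<bullet> u) \<le> g w + ereal (\<beta> \<bullet> w)"
  unfolding mixed_entropy_def \<phi> g[symmetric] scalar_prod_diff_right[OF \<beta> u w]
  by (cases "g u"; cases "g w") auto

text \<open>Minimization in stages: first on the fibres of \<open>H2\<close>, then over the values of \<open>H2\<close>.\<close>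

lemma canonical_iff_mixed_and_superdifferential:
  fixes \<beta>1 \<beta> :: "real vec"
  assumes H2: "\<And>x. H2 x \<in> carrier_vec d"
    and \<phi>: "(INF y. I y + ereal (\<beta>1 \<bullet> H1 y)) = ereal \<phi>"
    and \<beta>: "\<beta> \<in> carrier_vec d"
  shows "x \<in> canonical_macrostates I H1 H2 \<beta>1 \<beta> \<longleftrightarrow>
    x \<in> mixed_macrostates I H1 H2 \<beta>1 (H2 x) \<and>
    \<beta> \<in> superdifferential d (mixed_entropy I H1 H2 \<beta>1) (H2 x)"
proof -
  define f where "f = (\<lambda>x. I x + ereal (\<beta>1 \<bullet> H1 x))"
  define g where "g = (\<lambda>v. INF x\<in>{x. H2 x = v}. f x)"
  have g_eq: "g v = (INF x\<in>{x. H2 x = v}. I x + ereal (\<beta>1 \<bullet> H1 x))" for v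
    by (simp add: g_def f_def)
  have can: "x \<in> canonical_macrostates I H1 H2 \<beta>1 \<beta> \<longleftrightarrow>
      (\<forall>y. f x + ereal (\<beta> \<bullet> H2 x) \<le> f y + ereal (\<beta> \<bullet> H2 y))"
    by (simp add: canonical_macrostates_def f_def)
  have mix: "x \<in> mixed_macrostates I H1 H2 \<beta>1 (H2 x) \<longleftrightarrow> f x = g (H2 x)"
    by (simp add: mixed_macrostates_def f_def g_def)
  have sup: "\<beta> \<in> superdifferential d (mixed_entropy I H1 H2 \<beta>1) (H2 x) \<longleftrightarrow>
      (\<forall>w\<in>carrier_vec d. g (H2 x) + ereal (\<beta> \<bullet> H2 x) \<le> g w + ereal (\<beta> \<bullet> w))"
    using mixed_entropy_support_iff[where g = g, OF \<phi> \<beta> H2[of x] _ g_eq] \<beta>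
    by (simp add: superdifferential_def)
  have glow: "g (H2 y) \<le> f y" for y
    unfolding g_def by (rule INF_lower) simp
  have le_g: "a \<le> g w + ereal (\<beta> \<bullet> w) \<longleftrightarrow> (\<forall>y. H2 y = w \<longrightarrow> a \<le> f y + ereal (\<beta> \<bullet> w))" for a w
    unfolding g_def le_INF_add_real_iff by auto
  have stages: "(\<forall>w\<in>carrier_vec d. a \<le> g w + ereal (\<beta> \<bullet> w)) \<longleftrightarrow>
      (\<forall>y. a \<le> f y + ereal (\<beta> \<bullet> H2 y))" for a
    unfolding le_g using H2 by auto
  show ?thesis
    unfolding can mix sup
  proof
    assume min: "\<forall>y. f x + ereal (\<beta> \<bullet> H2 x) \<le> f y + ereal (\<beta> \<bullet> H2 y)"
    then have "f x + ereal (\<beta> \<bullet> H2 x) \<le> g (H2 x) + ereal (\<beta> \<bullet> H2 x)"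
      unfolding stages[symmetric] using H2 by blast
    then have "f x = g (H2 x)"
      using glow[of x] by (cases "f x"; cases "g (H2 x)") auto
    with min show "f x = g (H2 x) \<and>
        (\<forall>w\<in>carrier_vec d. g (H2 x) + ereal (\<beta> \<bullet> H2 x) \<le> g w + ereal (\<beta> \<bullet> w))"
      by (simp add: stages)
  next
    assume "f x = g (H2 x) \<and>
        (\<forall>w\<in>carrier_vec d. g (H2 x) + ereal (\<beta> \<bullet> H2 x) \<le> g w + ereal (\<beta> \<bullet> w))"
    then show "\<forall>y. f x + ereal (\<beta> \<bullet> H2 x) \<le> f y + ereal (\<beta> \<bullet> H2 y)"
      by (simp add: stages)
  qed
qed

section \<open>Consequences of the large deviation principle\<close>

text \<open>The upper bound for the closed set \<open>UNIV\<close>, whose probability is \<open>1\<close>, reads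
  \<open>0 \<le> - inf I\<close>.\<close>

lemma large_deviation_principle_finite_point:
  fixes I :: "'x::topological_space \<Rightarrow> ereal"
  assumes prob: "\<And>n. prob_space (M n)" and ldp: "large_deviation_principle M Y a I"
  obtains x where "I x < \<infinity>"
proof -
  have "limsup (\<lambda>n. ereal (1 / a n) * ereal_ln (measure (M n) (Y n -` UNIV \<inter> space (M n))))
      \<le> - (INF x. I x)"
    using ldp unfolding large_deviation_principle_def by blast
  moreover have "ereal (1 / a n) * ereal_ln (measure (M n) (Y n -` UNIV \<inter> space (M n))) = 0" for n
    using prob_space.prob_space[OF prob] by (simp add: ereal_ln_def)
  ultimately have "0 \<le> - (INF x. I x)"
    by (simp only: Limsup_const[OF sequentially_bot])
  then have "(INF x. I x) < \<infinity>"
    by (cases "INF x. I x") auto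
  then show ?thesis using that unfolding INF_less_iff by blast
qed

text \<open>Along a minimizing sequence \<open>I\<close> stays bounded, so the sequence stays in a compact level
  set; at a limit point, \<open>I\<close> cannot exceed its limiting value since level sets are closed.\<close>

lemma rate_function_perturbed_attains_INF:
  fixes I :: "'x::metric_space \<Rightarrow> ereal" and c :: "'x \<Rightarrow> real"
  assumes rate: "rate_function I" and cont: "continuous_on UNIV c" and lower: "\<And>x. b \<le> c x"
    and S: "closed S" and fin: "(INF x\<in>S. I x + ereal (c x)) < \<infinity>"
  shows "\<exists>x\<in>S. I x + ereal (c x) = (INF x\<in>S. I x + ereal (c x))"
proof -
  define f where "f = (\<lambda>x. I x + ereal (c x))"
  have pos: "0 \<le> I x" for x using rate by (auto simp: rate_function_def)
  have lvl: "compact {x. I x \<le> ereal L}" if "0 \<le> L" for L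
    using rate that by (auto simp: rate_function_def)
  have "ereal b \<le> f x" for x
    using add_mono[OF pos[of x], of "ereal b" "ereal (c x)"] lower by (simp add: f_def)
  then have "ereal b \<le> (INF x\<in>S. f x)" by (intro INF_greatest)
  then obtain r where r: "(INF x\<in>S. f x) = ereal r"
    using fin by (cases "INF x\<in>S. f x") (auto simp: f_def)
  have "\<exists>x\<in>S. f x < ereal (r + 1 / real (Suc n))" for n
  proof -
    have "(INF x\<in>S. f x) < ereal (r + 1 / real (Suc n))" unfolding r by simp
    then show ?thesis unfolding INF_less_iff .
  qed
  then obtain X where XS: "\<And>n. X n \<in> S" and Xf: "\<And>n. f (X n) < ereal (r + 1 / real (Suc n))"
    by metis
  define i where "i = (\<lambda>n. real_of_ereal (I (X n)))"
  have i: "I (X n) = ereal (i n)" for n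
    using Xf[of n] pos[of "X n"] by (cases "I (X n)") (auto simp: f_def i_def)
  have i0: "0 \<le> i n" for n using pos[of "X n"] by (simp add: i)
  have iX: "i n < r + 1 / real (Suc n) - c (X n)" for n
    using Xf[of n] by (simp add: f_def i)
  have le1: "1 / real (Suc n) \<le> 1" for n by simp
  have ib: "i n \<le> r + 1 - b" for n
    using iX[of n] lower[of "X n"] le1[of n] by linarith
  have "0 \<le> r + 1 - b" using i0[of 0] ib[of 0] by linarith
  then have "seq_compact {x. I x \<le> ereal (r + 1 - b)}"
    by (intro compact_imp_seq_compact lvl)
  then obtain x k where k: "strict_mono (k :: nat \<Rightarrow> nat)" and lim: "(X \<circ> k) \<longlonglongrightarrow> x"
    using ib by (auto elim!: seq_compactE[where f = X] simp: i)
  have xS: "x \<in> S" using closed_sequentially[OF S _ lim] XS by simp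
  have "(\<lambda>n. c (X (k n))) \<longlonglongrightarrow> c x"
    using continuous_on_tendsto_compose[OF cont lim] by (simp add: o_def)
  moreover have "(\<lambda>n. 1 / real (Suc (k n))) \<longlonglongrightarrow> 0"
    using LIMSEQ_subseq_LIMSEQ[OF LIMSEQ_Suc[OF lim_inverse_n'] k] by (simp add: o_def)
  ultimately have rhs: "(\<lambda>n. r + 1 / real (Suc (k n)) - c (X (k n))) \<longlonglongrightarrow> r + 0 - c x"
    by (intro tendsto_intros)
  have "0 \<le> r + 0 - c x"
    using i0 iX by (intro LIMSEQ_le_const[OF rhs]) (meson less_eq_real_def order.trans)
  have "I x \<le> ereal (r - c x) + ereal e" if e: "0 < e" for e :: real
  proof -
    have "\<forall>\<^sub>F n in sequentially. r + 1 / real (Suc (k n)) - c (X (k n)) < r - c x + e"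
      using order_tendstoD(2)[OF rhs, of "r - c x + e"] e by simp
    then have ev: "\<forall>\<^sub>F n in sequentially. (X \<circ> k) n \<in> {y. I y \<le> ereal (r - c x + e)}"
    proof eventually_elim
      case (elim n)
      then show ?case using iX[of "k n"] by (simp add: i)
    qed
    have "closed {y. I y \<le> ereal (r - c x + e)}"
      using \<open>0 \<le> r + 0 - c x\<close> e by (intro compact_imp_closed lvl) simp
    from Lim_in_closed_set[OF this ev _ lim] show ?thesis by simp
  qed
  then have "I x \<le> ereal (r - c x)" by (rule ereal_le_epsilon2)
  then have "f x \<le> ereal r" by (cases "I x") (auto simp: f_def)
  moreover have "ereal r \<le> f x" unfolding r[symmetric] using xS by (rule INF_lower)
  ultimately show ?thesis using xS r by (intro bexI[of _ x]) (auto simp: f_def)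
qed

section \<open>Equivalence of ensembles\<close>

theorem mainTheorem9:
  fixes M :: "nat \<Rightarrow> 'w measure"
    and \<sigma> \<tau> :: nat
    and H :: "nat \<Rightarrow> nat \<Rightarrow> 'w \<Rightarrow> real"
    and a :: "nat \<Rightarrow> real"
    and Y :: "nat \<Rightarrow> 'w \<Rightarrow> 'x::polish_space"
    and Ht :: "nat \<Rightarrow> 'x \<Rightarrow> real"
    and I :: "'x \<Rightarrow> ereal"
    and H1 H2 :: "'x \<Rightarrow> real vec"
  assumes prob: "\<And>n. prob_space (M n)"
    and sigma: "2 \<le> \<sigma>"
    and tau: "1 \<le> \<tau>" "\<tau> \<le> \<sigma>"
    and H_meas: "\<And>n i. i < \<sigma> \<Longrightarrow> H n i \<in> borel_measurable (M n)"
    and H_bdd: "\<And>n i. i < \<sigma> \<Longrightarrow> bounded (H n i ` space (M n))"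
    and a_pos: "\<And>n. 0 < a n"
    and a_lim: "filterlim a at_top sequentially"
    and Y_meas: "\<And>n. Y n \<in> measurable (M n) borel"
    and Ht_bdd: "\<And>i. i < \<sigma> \<Longrightarrow> bounded (range (Ht i))"
    and Ht_cont: "\<And>i. i < \<sigma> \<Longrightarrow> continuous_on UNIV (Ht i)"
    and H_approx: "\<And>i. i < \<sigma> \<Longrightarrow>
          (\<lambda>n. SUP \<omega>\<in>space (M n). \<bar>H n i \<omega> - Ht i (Y n \<omega>)\<bar>) \<longlonglongrightarrow> 0"
    and rate: "rate_function I"
    and ldp: "large_deviation_principle M Y a I"
    and H1_eq: "H1 = (\<lambda>x. vec \<tau> (\<lambda>i. Ht i x))"
    and H2_eq: "H2 = (\<lambda>x. vec (\<sigma> - \<tau>) (\<lambda>i. Ht (\<tau> + i) x))"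
  shows
    "(\<forall>\<beta>1\<in>carrier_vec \<tau>. \<forall>\<beta>2\<in>carrier_vec (\<sigma> - \<tau>).
        canonical_macrostates I H1 H2 \<beta>1 \<beta>2 =
          (\<Union>u2\<in>H2 ` canonical_macrostates I H1 H2 \<beta>1 \<beta>2. mixed_macrostates I H1 H2 \<beta>1 u2)) \<and>
     (\<forall>\<beta>1\<in>carrier_vec \<tau>. \<forall>u2\<in>concave_dom (\<sigma> - \<tau>) (mixed_entropy I H1 H2 \<beta>1).
        let s = mixed_entropy I H1 H2 \<beta>1;
            s_bidual = legendre_fenchel (\<sigma> - \<tau>) (legendre_fenchel (\<sigma> - \<tau>) s);
            C = support_points (\<sigma> - \<tau>) s;
            T = strict_support_points (\<sigma> - \<tau>) s
        in
          (u2 \<in> C \<and> u2 \<in> T \<longrightarrow>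
            (\<exists>\<beta>2\<in>superdifferential (\<sigma> - \<tau>) s_bidual u2.
               mixed_macrostates I H1 H2 \<beta>1 u2 = canonical_macrostates I H1 H2 \<beta>1 \<beta>2)) \<and>
          (u2 \<in> C \<and> u2 \<notin> T \<longrightarrow>
            (\<forall>\<beta>2\<in>superdifferential (\<sigma> - \<tau>) s_bidual u2.
               mixed_macrostates I H1 H2 \<beta>1 u2 \<subset> canonical_macrostates I H1 H2 \<beta>1 \<beta>2)) \<and>
          (u2 \<notin> C \<longrightarrow>
            (\<forall>\<beta>2\<in>carrier_vec (\<sigma> - \<tau>).
               mixed_macrostates I H1 H2 \<beta>1 u2 \<inter> canonical_macrostates I H1 H2 \<beta>1 \<beta>2 = {})))"
proof -
  let ?d = "\<sigma> - \<tau>"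
  have H2c: "\<And>x. H2 x \<in> carrier_vec ?d" by (simp add: H2_eq)
  have c_eq: "\<beta>1 \<bullet> H1 x = (\<Sum>i<\<tau>. \<beta>1 $ i * Ht i x)" for \<beta>1 x
    by (simp add: H1_eq scalar_prod_def atLeast0LessThan)
  have c_cont: "continuous_on UNIV (\<lambda>x. \<beta>1 \<bullet> H1 x)" for \<beta>1
    unfolding c_eq using tau Ht_cont by (intro continuous_intros) auto
  have c_lower: "\<exists>b. \<forall>x. b \<le> \<beta>1 \<bullet> H1 x" for \<beta>1
  proof -
    have "\<forall>i<\<tau>. \<exists>B. \<forall>x. \<bar>Ht i x\<bar> \<le> B"
      using Ht_bdd tau by (force simp: bounded_iff)
    then obtain B where B: "\<And>i x. i < \<tau> \<Longrightarrow> \<bar>Ht i x\<bar> \<le> B i" by metis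
    have "- (\<Sum>i<\<tau>. \<bar>\<beta>1 $ i\<bar> * B i) \<le> \<beta>1 \<bullet> H1 x" for x
    proof -
      have "\<bar>\<beta>1 $ i * Ht i x\<bar> \<le> \<bar>\<beta>1 $ i\<bar> * B i" if "i < \<tau>" for i
        unfolding abs_mult using B[OF that] by (intro mult_left_mono) auto
      then have "- (\<bar>\<beta>1 $ i\<bar> * B i) \<le> \<beta>1 $ i * Ht i x" if "i < \<tau>" for i
        using that by (meson abs_le_D2 minus_le_iff)
      then show ?thesis
        unfolding c_eq sum_negf[symmetric] by (intro sum_mono) auto
    qed
    then show ?thesis by blast
  qed
  have I_pos: "0 \<le> I x" for x using rate by (auto simp: rate_function_def)
  obtain x0 where x0: "I x0 < \<infinity>"
    using large_deviation_principle_finite_point[OF prob ldp] .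
  have \<phi>_ex: "\<exists>\<phi>. (INF y. I y + ereal (\<beta>1 \<bullet> H1 y)) = ereal \<phi>" for \<beta>1
  proof -
    obtain b where b: "\<And>x. b \<le> \<beta>1 \<bullet> H1 x" using c_lower by blast
    have "ereal b \<le> (INF y. I y + ereal (\<beta>1 \<bullet> H1 y))"
      using add_mono[OF I_pos, of "ereal b"] b by (intro INF_greatest) simp
    moreover have "(INF y. I y + ereal (\<beta>1 \<bullet> H1 y)) \<le> I x0 + ereal (\<beta>1 \<bullet> H1 x0)"
      by (rule INF_lower) simp
    ultimately show ?thesis
      using x0 by (cases "INF y. I y + ereal (\<beta>1 \<bullet> H1 y)"; cases "I x0") auto
  qed
  have key: "x \<in> canonical_macrostates I H1 H2 \<beta>1 \<beta>2 \<longleftrightarrow>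
      x \<in> mixed_macrostates I H1 H2 \<beta>1 (H2 x) \<and>
      \<beta>2 \<in> superdifferential ?d (mixed_entropy I H1 H2 \<beta>1) (H2 x)"
    if "\<beta>2 \<in> carrier_vec ?d" for \<beta>1 \<beta>2 x
  proof -
    obtain \<phi> where "(INF y. I y + ereal (\<beta>1 \<bullet> H1 y)) = ereal \<phi>" using \<phi>_ex by blast
    from canonical_iff_mixed_and_superdifferential[where I = I, OF H2c this that] show ?thesis .
  qed
  have fibre: "H2 x = u" if "x \<in> mixed_macrostates I H1 H2 \<beta>1 u" for x u \<beta>1
    using that by (simp add: mixed_macrostates_def)
  have mixed_sub: "mixed_macrostates I H1 H2 \<beta>1 u \<subseteq> canonical_macrostates I H1 H2 \<beta>1 \<beta>2"
    if "\<beta>2 \<in> superdifferential ?d (mixed_entropy I H1 H2 \<beta>1) u" for \<beta>1 \<beta>2 u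
  proof
    fix x assume x: "x \<in> mixed_macrostates I H1 H2 \<beta>1 u"
    then show "x \<in> canonical_macrostates I H1 H2 \<beta>1 \<beta>2"
      using key[of \<beta>2 x \<beta>1] that fibre[OF x] by (simp add: superdifferential_def)
  qed
  have attained: "mixed_macrostates I H1 H2 \<beta>1 u \<noteq> {}"
    if fin: "mixed_entropy I H1 H2 \<beta>1 u \<noteq> -\<infinity>" for \<beta>1 u
  proof -
    let ?S = "{x. H2 x = u}"
    obtain \<phi> where \<phi>: "(INF y. I y + ereal (\<beta>1 \<bullet> H1 y)) = ereal \<phi>" using \<phi>_ex by blast
    have g_fin: "(INF x\<in>?S. I x + ereal (\<beta>1 \<bullet> H1 x)) < \<infinity>"
      using fin unfolding mixed_entropy_def \<phi>
      by (cases "INF x\<in>?S. I x + ereal (\<beta>1 \<bullet> H1 x)") auto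
    obtain b where b: "\<And>x. b \<le> \<beta>1 \<bullet> H1 x" using c_lower by blast
    have "?S = (if dim_vec u = ?d then \<Inter>i<?d. {x. Ht (\<tau> + i) x = u $ i} else {})"
      by (auto simp: H2_eq vec_eq_iff)
    moreover have "closed {x. Ht (\<tau> + i) x = u $ i}" if "i < ?d" for i
      using Ht_cont that by (intro closed_Collect_eq continuous_intros) auto
    ultimately have "closed ?S" by auto
    from rate_function_perturbed_attains_INF[OF rate c_cont b this g_fin]
    show ?thesis by (auto simp: mixed_macrostates_def)
  qed
  show ?thesis
  proof (rule conjI; intro ballI; (unfold Let_def)?)
    fix \<beta>1 \<beta>2 :: "real vec"
    assume \<beta>2: "\<beta>2 \<in> carrier_vec ?d"
    show "canonical_macrostates I H1 H2 \<beta>1 \<beta>2 =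
        (\<Union>u2\<in>H2 ` canonical_macrostates I H1 H2 \<beta>1 \<beta>2. mixed_macrostates I H1 H2 \<beta>1 u2)"
      using key[OF \<beta>2] mixed_sub by blast
  next
    fix \<beta>1 u2 :: "real vec"
    let ?s = "mixed_entropy I H1 H2 \<beta>1"
    let ?b = "legendre_fenchel ?d (legendre_fenchel ?d ?s)"
    assume u2dom: "u2 \<in> concave_dom ?d ?s"
    then have u2: "u2 \<in> carrier_vec ?d" and u2_low: "?s u2 \<noteq> -\<infinity>"
      by (auto simp: concave_dom_def)
    obtain \<phi> where \<phi>: "(INF y. I y + ereal (\<beta>1 \<bullet> H1 y)) = ereal \<phi>" using \<phi>_ex by blast
    have "(INF y. I y + ereal (\<beta>1 \<bullet> H1 y)) \<le> (INF x\<in>{x. H2 x = u2}. I x + ereal (\<beta>1 \<bullet> H1 x))"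
      by (rule INF_superset_mono) auto
    then have "?s u2 \<noteq> \<infinity>"
      unfolding mixed_entropy_def \<phi>
      by (cases "INF x\<in>{x. H2 x = u2}. I x + ereal (\<beta>1 \<bullet> H1 x)") auto
    with u2_low have s_fin: "\<bar>?s u2\<bar> \<noteq> \<infinity>" by auto
    have C_iff: "u2 \<in> support_points ?d ?s \<longleftrightarrow> superdifferential ?d ?s u2 \<noteq> {}"
      using u2 by (auto simp: support_points_def superdifferential_def)
    have bidual: "superdifferential ?d ?b u2 = superdifferential ?d ?s u2"
      if "u2 \<in> support_points ?d ?s"
      using superdifferential_bidual[where s = ?s, OF u2 s_fin] that by (simp add: C_iff)
    show "(u2 \<in> support_points ?d ?s \<and> u2 \<in> strict_support_points ?d ?s \<longrightarrow>
            (\<exists>\<beta>2\<in>superdifferential ?d ?b u2.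
               mixed_macrostates I H1 H2 \<beta>1 u2 = canonical_macrostates I H1 H2 \<beta>1 \<beta>2)) \<and>
          (u2 \<in> support_points ?d ?s \<and> u2 \<notin> strict_support_points ?d ?s \<longrightarrow>
            (\<forall>\<beta>2\<in>superdifferential ?d ?b u2.
               mixed_macrostates I H1 H2 \<beta>1 u2 \<subset> canonical_macrostates I H1 H2 \<beta>1 \<beta>2)) \<and>
          (u2 \<notin> support_points ?d ?s \<longrightarrow>
            (\<forall>\<beta>2\<in>carrier_vec ?d.
               mixed_macrostates I H1 H2 \<beta>1 u2 \<inter> canonical_macrostates I H1 H2 \<beta>1 \<beta>2 = {}))"
    proof (intro conjI impI ballI; (elim conjE)?)
      assume C: "u2 \<in> support_points ?d ?s" and "u2 \<in> strict_support_points ?d ?s"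
      then obtain \<beta>2 where \<beta>2: "\<beta>2 \<in> carrier_vec ?d"
        and strict: "\<And>w. w \<in> carrier_vec ?d \<Longrightarrow> w \<noteq> u2 \<Longrightarrow>
                       ?s w < ?s u2 + ereal (\<beta>2 \<bullet> (w - u2))"
        by (auto simp: strict_support_points_def)
      have "?s w \<le> ?s u2 + ereal (\<beta>2 \<bullet> (w - u2))" if w: "w \<in> carrier_vec ?d" for w
        using strict[OF w] scalar_prod_diff_right[OF \<beta>2 u2 u2]
        by (cases "w = u2") (auto simp flip: zero_ereal_def)
      then have sup: "\<beta>2 \<in> superdifferential ?d ?s u2"
        using \<beta>2 by (simp add: superdifferential_def)
      have "canonical_macrostates I H1 H2 \<beta>1 \<beta>2 \<subseteq> mixed_macrostates I H1 H2 \<beta>1 u2"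
      proof
        fix x assume "x \<in> canonical_macrostates I H1 H2 \<beta>1 \<beta>2"
        then have x: "x \<in> mixed_macrostates I H1 H2 \<beta>1 (H2 x)"
          and "\<beta>2 \<in> superdifferential ?d ?s (H2 x)"
          using key[OF \<beta>2] by auto
        then have "H2 x = u2"
          using strict_support_excludes_other_support[where s = ?s, OF u2 H2c strict[OF H2c]]
          by blast
        with x show "x \<in> mixed_macrostates I H1 H2 \<beta>1 u2" by simp
      qed
      with mixed_sub[OF sup] sup bidual[OF C]
      show "\<exists>\<beta>2\<in>superdifferential ?d ?b u2.
          mixed_macrostates I H1 H2 \<beta>1 u2 = canonical_macrostates I H1 H2 \<beta>1 \<beta>2"
        by blast
    next
      fix \<beta>2
      assume C: "u2 \<in> support_points ?d ?s" and nT: "u2 \<notin> strict_support_points ?d ?s"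
        and "\<beta>2 \<in> superdifferential ?d ?b u2"
      then have sup: "\<beta>2 \<in> superdifferential ?d ?s u2" using bidual by simp
      then have \<beta>2: "\<beta>2 \<in> carrier_vec ?d" by (simp add: superdifferential_def)
      obtain w where w: "w \<in> carrier_vec ?d" and ne: "w \<noteq> u2"
        and touch: "?s u2 + ereal (\<beta>2 \<bullet> (w - u2)) \<le> ?s w"
        using nT u2 \<beta>2 by (auto simp: strict_support_points_def not_less)
      have "mixed_macrostates I H1 H2 \<beta>1 w \<subseteq> canonical_macrostates I H1 H2 \<beta>1 \<beta>2"
        by (intro mixed_sub superdifferential_touching[OF u2 w s_fin sup touch])
      moreover have "?s w \<noteq> -\<infinity>" using touch u2_low by auto
      then obtain x where "x \<in> mixed_macrostates I H1 H2 \<beta>1 w" using attained by blast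
      moreover from this have "x \<notin> mixed_macrostates I H1 H2 \<beta>1 u2"
        using fibre ne by blast
      ultimately show "mixed_macrostates I H1 H2 \<beta>1 u2 \<subset> canonical_macrostates I H1 H2 \<beta>1 \<beta>2"
        using mixed_sub[OF sup] by blast
    next
      fix \<beta>2 :: "real vec"
      assume "u2 \<notin> support_points ?d ?s" and \<beta>2: "\<beta>2 \<in> carrier_vec ?d"
      then show "mixed_macrostates I H1 H2 \<beta>1 u2 \<inter> canonical_macrostates I H1 H2 \<beta>1 \<beta>2 = {}"
        using key[OF \<beta>2] fibre unfolding C_iff by blast
    qed
  qed
qed

end
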